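(* Let $N\ge 1$ be an integer, let $\alpha\ge 0$, $A>0$, and let $\rho:\mathbb{R}^N\to\mathbb{R}$ be a radial continuous function with $\rho(x)\ge A(1+|x|^2)^{\alpha/2}$ for all $x\in\mathbb{R}^N$. Let $p>1$ and consider the equation $$-\Delta u=\rho(x)u^p,\qquad u>0\quad\text{in }\mathbb{R}^N, \tag{E}$$ together with the condition $$N<2+\frac{2(2+\alpha)}{p-1}\left(p+\sqrt{p^2-p}\right). \tag{C}$$ (i) If $p>\frac43$ and (C) holds, then (E) has no stable classical solution. In particular, if $N\le 10+4\alpha$, then (E) has no stable classical solution for any $p>\frac43$. (ii) If $1<p\le\frac43$ and (C) holds, then (E) has no bounded stable classical solution. Therefore, if $N\le 10+4\alpha$, there is no bounded stable classical solution of (E) for any $p>1$.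
   Context: A classical solution $u$ of $-\Delta u=\rho u^p$, $u>0$ in $\mathbb{R}^N$ is called stable if $$p\int_{\mathbb{R}^N}\rho(x)u^{p-1}\phi^2\,dx\le\int_{\mathbb{R}^N}|\nabla\phi|^2\,dx\qquad\text{for all }\phi\in C_c^1(\mathbb{R}^N).$$ *)

theory Defs
  imports "HOL-Analysis.Analysis"
begin

definition partial_deriv :: "'a::euclidean_space \<Rightarrow> ('a \<Rightarrow> real) \<Rightarrow> 'a \<Rightarrow> real" where
  "partial_deriv b f x = deriv (\<lambda>t. f (x + t *\<^sub>R b)) 0"

definition gradient :: "('a::euclidean_space \<Rightarrow> real) \<Rightarrow> 'a \<Rightarrow> 'a" where
  "gradient f x = (\<Sum>b\<in>Basis. partial_deriv b f x *\<^sub>R b)"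

lemma GDERIV_gradient:
  assumes "f differentiable (at x)"
  shows "GDERIV f x :> gradient f x"
proof -
  obtain D where D: "(f has_derivative D) (at x)"
    using assms by (auto simp: differentiable_def)
  have lin: "linear D" using D by (rule has_derivative_linear)
  have pd: "partial_deriv b f x = D b" for b
  proof -
    have D': "(f has_derivative D) (at (x + 0 *\<^sub>R b))" using D by simp
    have "((\<lambda>t::real. x + t *\<^sub>R b) has_derivative (\<lambda>t. t *\<^sub>R b)) (at 0)"
      by (auto intro!: derivative_eq_intros)
    from has_derivative_compose[OF this D']
    have "((\<lambda>t. f (x + t *\<^sub>R b)) has_derivative (\<lambda>t. D b * t)) (at 0)"
      by (simp add: linear_cmul[OF lin] mult.commute)
    then have "((\<lambda>t. f (x + t *\<^sub>R b)) has_field_derivative D b) (at 0)"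
      by (simp add: has_field_derivative_def)
    then show ?thesis unfolding partial_deriv_def by (rule DERIV_imp_deriv)
  qed
  have "D h = h \<bullet> gradient f x" for h
  proof -
    have "D h = D (\<Sum>b\<in>Basis. (h \<bullet> b) *\<^sub>R b)" by (simp add: euclidean_representation)
    also have "\<dots> = (\<Sum>b\<in>Basis. (h \<bullet> b) * D b)"
      by (simp add: linear_sum[OF lin] linear_cmul[OF lin])
    also have "\<dots> = h \<bullet> gradient f x"
      by (simp add: gradient_def pd inner_sum_right mult.commute)
    finally show ?thesis .
  qed
  then have "D = (\<lambda>h. h \<bullet> gradient f x)" by auto
  with D show ?thesis by (simp add: gderiv_def)
qed

definition laplacian :: "('a::euclidean_space \<Rightarrow> real) \<Rightarrow> 'a \<Rightarrow> real" where
  "laplacian f x = (\<Sum>b\<in>Basis. partial_deriv b (partial_deriv b f) x)"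

text \<open>Since \<^const>\<open>deriv\<close> is total, differentiability has to be demanded
  separately from continuity of the partial derivatives.\<close>

definition C1 :: "('a::euclidean_space \<Rightarrow> real) \<Rightarrow> bool" where
  "C1 f \<longleftrightarrow> (\<forall>x. f differentiable (at x)) \<and>
     (\<forall>b\<in>Basis. continuous_on UNIV (partial_deriv b f))"

definition C2 :: "('a::euclidean_space \<Rightarrow> real) \<Rightarrow> bool" where
  "C2 f \<longleftrightarrow> C1 f \<and> (\<forall>b\<in>Basis. C1 (partial_deriv b f))"

definition C1_compact_support :: "('a::euclidean_space \<Rightarrow> real) \<Rightarrow> bool" where
  "C1_compact_support \<phi> \<longleftrightarrow> C1 \<phi> \<and> compact (closure {x. \<phi> x \<noteq> 0})"

definition radial :: "('a::euclidean_space \<Rightarrow> real) \<Rightarrow> bool" where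
  "radial f \<longleftrightarrow> (\<forall>x y. norm x = norm y \<longrightarrow> f x = f y)"

definition classical_solution ::
    "('a::euclidean_space \<Rightarrow> real) \<Rightarrow> real \<Rightarrow> ('a \<Rightarrow> real) \<Rightarrow> bool" where
  "classical_solution \<rho> p u \<longleftrightarrow>
     C2 u \<and> (\<forall>x. u x > 0) \<and> (\<forall>x. - laplacian u x = \<rho> x * u x powr p)"

text \<open>For \<open>\<rho>\<close> continuous and \<open>u\<close> a classical solution, both integrands are continuous
  with compact support, so the convention that non-integrable functions have integral
  \<open>0\<close> plays no role.\<close>

definition stable_solution ::
    "('a::euclidean_space \<Rightarrow> real) \<Rightarrow> real \<Rightarrow> ('a \<Rightarrow> real) \<Rightarrow> bool" where
  "stable_solution \<rho> p u \<longleftrightarrow> classical_solution \<rho> p u \<and>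
     (\<forall>\<phi>. C1_compact_support \<phi> \<longrightarrow>
        p * (\<integral>x. \<rho> x * u x powr (p - 1) * (\<phi> x)\<^sup>2 \<partial>lborel)
          \<le> (\<integral>x. (norm (gradient \<phi> x))\<^sup>2 \<partial>lborel))"

end

theory Submission imports Defs begin

text \<open>
  The proof is Farina's integral estimate. Let \<open>u\<close> be a stable solution and let \<open>\<eta>\<close> be
  \<open>C\<^sup>1\<close> with compact support. The stability inequality with test function
  \<open>u\<^sup>s \<eta>\<close> bounds \<open>p \<integral> \<rho> u\<^bsup>p+2s-1\<^esup> \<eta>\<^sup>2\<close> by
  \<open>s\<^sup>2 \<integral> u\<^bsup>2s-2\<^esup> \<eta>\<^sup>2 |\<nabla>u|\<^sup>2\<close> plus terms that contain \<open>\<nabla>\<eta>\<close>.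
  The equation multiplied by \<open>u\<^bsup>2s-1\<^esup> \<eta>\<^sup>2\<close> and integrated by parts expresses the same
  weighted integral as \<open>(2s-1) \<integral> u\<^bsup>2s-2\<^esup> \<eta>\<^sup>2 |\<nabla>u|\<^sup>2\<close> plus terms that contain
  \<open>\<nabla>\<eta>\<close>. The two are incompatible up to the \<open>\<nabla>\<eta>\<close>-terms as soon as
  \<open>p (2s-1) > s\<^sup>2\<close>, that is, for every \<open>s > 1\<close> strictly between \<open>p - \<surd>(p\<^sup>2-p)\<close> and
  \<open>p + \<surd>(p\<^sup>2-p)\<close>, and then
  \<open>\<integral> \<rho> u\<^bsup>p+2s-1\<^esup> \<eta>\<^sup>2 \<le> C \<integral> u\<^bsup>2s\<^esup> |\<nabla>\<eta>|\<^sup>2\<close>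
  with \<open>C\<close> depending on \<open>p\<close> and \<open>s\<close> only (\<open>stable_energy_estimate\<close>).

  For \<open>\<eta>\<close> take a high power of a cutoff at scale \<open>R\<close>. Since \<open>p > 1\<close>, the left-hand
  integrand carries the higher power of \<open>u\<close>, so wherever the right-hand integrand is not absorbed
  by half of the left-hand one, \<open>u\<close> is bounded explicitly in terms of \<open>R\<close> and the lower bound
  \<open>A R\<^sup>\<alpha>\<close> of \<open>\<rho>\<close> on the support of \<open>\<nabla>\<eta>\<close>
  (\<open>gradient_term_dichotomy\<close>). Integrating this bound over a ball of radius \<open>2R\<close> gives
  \<open>\<integral> \<rho> u\<^bsup>p+2s-1\<^esup> \<eta>\<^sup>2 \<le> L R\<^bsup>N - 2 - (2+\<alpha>) 2s/(p-1)\<^esup>\<close>.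
  The condition on \<open>N\<close> says precisely that the exponent is negative for \<open>s\<close> close to
  \<open>p + \<surd>(p\<^sup>2-p)\<close>, and letting \<open>R\<close> tend to infinity contradicts the positivity of
  \<open>\<rho> u\<^bsup>p+2s-1\<^esup>\<close> (\<open>no_stable_solution\<close>). All claims of the corollary are instances of
  this, because \<open>N \<le> 10 + 4\<alpha>\<close> implies the condition on \<open>N\<close> for every \<open>p > 1\<close>
  (\<open>condition_of_dim_le\<close>).
\<close>

section \<open>Gradients of \<open>C\<^sup>1\<close> functions\<close>

lemma gradient_eqI:
  assumes "GDERIV f x :> g"
  shows "gradient f x = g"
proof -
  have "f differentiable (at x)"
    using assms unfolding gderiv_def differentiable_def by blast
  from GDERIV_gradient[OF this] have "(\<lambda>h. h \<bullet> gradient f x) = (\<lambda>h. h \<bullet> g)"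
    using assms has_derivative_unique unfolding gderiv_def by blast
  then have "(gradient f x - g) \<bullet> (gradient f x - g) = 0"
    by (metis inner_diff_right right_minus_eq)
  then show ?thesis by simp
qed

lemma gradient_inner_Basis: "b \<in> Basis \<Longrightarrow> gradient f x \<bullet> b = partial_deriv b f x"
  by (simp add: gradient_def)

text \<open>
  The coordinate-free form of \<open>C\<^sup>1\<close>: it makes the calculus rules for \<open>GDERIV\<close> applicable,
  so that products and compositions need no computation with partial derivatives.
\<close>
lemma C1_iff_continuous_gradient:
  "C1 f \<longleftrightarrow> (\<forall>x. GDERIV f x :> gradient f x) \<and> continuous_on UNIV (gradient f)"
proof
  assume "C1 f"
  then show "(\<forall>x. GDERIV f x :> gradient f x) \<and> continuous_on UNIV (gradient f)"
    unfolding C1_def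
    using GDERIV_gradient by (auto simp: gradient_def[abs_def] intro!: continuous_intros)
next
  assume *: "(\<forall>x. GDERIV f x :> gradient f x) \<and> continuous_on UNIV (gradient f)"
  have "continuous_on UNIV (partial_deriv b f)" if "b \<in> Basis" for b
  proof -
    have "partial_deriv b f = (\<lambda>x. gradient f x \<bullet> b)"
      using that by (auto simp: gradient_inner_Basis)
    then show ?thesis using * by (auto intro!: continuous_intros)
  qed
  then show "C1 f"
    using * unfolding C1_def gderiv_def differentiable_def by blast
qed

lemma C1_GDERIV: "C1 f \<Longrightarrow> GDERIV f x :> gradient f x"
  and C1_continuous_gradient: "C1 f \<Longrightarrow> continuous_on S (gradient f)"
  using C1_iff_continuous_gradient continuous_on_subset by blast+

lemma C1_continuous: "C1 f \<Longrightarrow> continuous_on S f"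
  unfolding C1_def
  by (meson continuous_at_imp_continuous_on differentiable_imp_continuous_within)

lemma C1I:
  assumes "\<And>x. GDERIV f x :> g x" "continuous_on UNIV g"
  shows "C1 f"
proof -
  have "gradient f = g" using assms(1) gradient_eqI by blast
  then show ?thesis using assms by (simp add: C1_iff_continuous_gradient)
qed

lemma gradient_mult:
  "C1 f \<Longrightarrow> C1 g \<Longrightarrow>
    gradient (\<lambda>x. f x * g x) x = f x *\<^sub>R gradient g x + g x *\<^sub>R gradient f x"
  by (intro gradient_eqI GDERIV_mult C1_GDERIV)

lemma C1_mult: "C1 f \<Longrightarrow> C1 g \<Longrightarrow> C1 (\<lambda>x. f x * g x)"
  by (rule C1I, rule GDERIV_mult)
    (auto intro!: C1_GDERIV continuous_intros C1_continuous_gradient C1_continuous)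

lemma
  assumes "C1 f" and h: "\<And>t. t \<in> range f \<Longrightarrow> (h has_field_derivative h' t) (at t)"
    and h': "continuous_on (range f) h'"
  shows gradient_compose: "gradient (\<lambda>x. h (f x)) x = h' (f x) *\<^sub>R gradient f x"
    and C1_compose: "C1 (\<lambda>x. h (f x))"
proof -
  have *: "GDERIV (\<lambda>x. h (f x)) x :> h' (f x) *\<^sub>R gradient f x" for x
    using GDERIV_DERIV_compose[OF C1_GDERIV[OF \<open>C1 f\<close>] h] by blast
  then show "gradient (\<lambda>x. h (f x)) x = h' (f x) *\<^sub>R gradient f x"
    by (rule gradient_eqI)
  have "continuous_on UNIV (\<lambda>x. h' (f x))"
    by (rule continuous_on_compose2[OF h']) (auto simp: C1_continuous \<open>C1 f\<close>)
  then show "C1 (\<lambda>x. h (f x))"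
    by (intro C1I[OF *] continuous_intros C1_continuous_gradient \<open>C1 f\<close>)
qed

lemma
  assumes "C1 u" "\<And>x. u x > 0"
  shows gradient_powr:
      "gradient (\<lambda>x. u x powr s) x = (s * u x powr (s - 1)) *\<^sub>R gradient u x"
    and C1_powr: "C1 (\<lambda>x. u x powr s)"
proof -
  have *: "((\<lambda>t. t powr s) has_field_derivative s * t powr (s - 1)) (at t)" if "t \<in> range u" for t
    using that assms(2) by (auto intro!: has_real_derivative_powr)
  have **: "continuous_on (range u) (\<lambda>t. s * t powr (s - 1))"
    using assms(2) by (auto intro!: continuous_intros simp: less_imp_neq[symmetric])
  show "gradient (\<lambda>x. u x powr s) x = (s * u x powr (s - 1)) *\<^sub>R gradient u x"
    using gradient_compose[OF assms(1) * **] by simp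
  show "C1 (\<lambda>x. u x powr s)" using C1_compose[OF assms(1) * **] by simp
qed

lemma C1_compact_supportI:
  fixes f :: "'a::euclidean_space \<Rightarrow> real"
  assumes "C1 f" "\<And>x. r < norm x \<Longrightarrow> f x = 0"
  shows "C1_compact_support f"
proof -
  have "{x. f x \<noteq> 0} \<subseteq> cball 0 r" using assms(2) by (force simp: not_le[symmetric])
  then have "bounded {x. f x \<noteq> 0}" using bounded_cball bounded_subset by blast
  then show ?thesis using \<open>C1 f\<close> by (simp add: C1_compact_support_def)
qed

lemma gradient_eq_0_outside:
  fixes f :: "'a::euclidean_space \<Rightarrow> real"
  assumes "C1 f" "\<And>x. r < norm x \<Longrightarrow> f x = 0" "r < norm x"
  shows "gradient f x = 0"
proof -
  have "open {y::'a. r < norm y}" by (intro open_Collect_less continuous_intros)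
  then have "GDERIV f x :> 0"
    unfolding gderiv_def
    using has_derivative_transform_within_open[of "\<lambda>_. 0" "\<lambda>h. h \<bullet> 0" x UNIV "{y. r < norm y}" f]
      assms(2,3) by auto
  then show ?thesis by (rule gradient_eqI)
qed

lemma integrable_continuous_vanishing:
  fixes f :: "'a::euclidean_space \<Rightarrow> real"
  assumes "continuous_on UNIV f" "\<And>x. r < norm x \<Longrightarrow> f x = 0"
  shows "integrable lborel f"
proof -
  have "integrable lborel (\<lambda>x. indicator (cball 0 r) x *\<^sub>R f x)"
    by (rule borel_integrable_compact) (use assms(1) continuous_on_subset in auto)
  also have "(\<lambda>x. indicator (cball 0 r) x *\<^sub>R f x) = f"
    using assms(2) by (force simp: indicator_def)
  finally show ?thesis .
qed

section \<open>Integration by parts\<close>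

text \<open>
  The difference quotients of \<open>f\<close> in direction \<open>b\<close> integrate to zero because Lebesgue
  measure is translation invariant. By the mean value theorem they are bounded uniformly in the step,
  with support in one fixed ball, so dominated convergence passes to the derivative.
\<close>
lemma integral_partial_deriv_eq_0:
  fixes f :: "'a::euclidean_space \<Rightarrow> real"
  assumes f: "C1 f" and supp: "\<And>x. r < norm x \<Longrightarrow> f x = 0" and b: "b \<in> Basis"
  shows "(\<integral>x. gradient f x \<bullet> b \<partial>lborel) = 0"
proof -
  define h where
    "h n x = (f (x + inverse (real (Suc n)) *\<^sub>R b) - f x) / inverse (real (Suc n))" for n x
  define F where "F x t = f (x + t *\<^sub>R b)" for x t
  have F: "(F x has_field_derivative gradient f (x + t *\<^sub>R b) \<bullet> b) (at t)" for x t
  proof -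
    have "((\<lambda>t::real. x + t *\<^sub>R b) has_derivative (\<lambda>t. t *\<^sub>R b)) (at t)"
      by (auto intro!: derivative_eq_intros)
    from has_derivative_compose[OF this C1_GDERIV[OF f, unfolded gderiv_def]]
    show ?thesis
      by (simp add: has_field_derivative_def F_def[abs_def] inner_commute mult_commute_abs)
  qed
  obtain M where M: "\<And>x. norm x \<le> r + 2 \<Longrightarrow> norm (gradient f x) \<le> M" "0 \<le> M"
  proof -
    have "compact (gradient f ` cball 0 (r + 2))"
      by (intro compact_continuous_image C1_continuous_gradient f) auto
    then obtain B where "\<forall>y\<in>gradient f ` cball 0 (r + 2). norm y \<le> B"
      using compact_imp_bounded bounded_iff by metis
    then show thesis by (intro that[of "max B 0"]) (auto simp: le_max_iff_disj)
  qed
  have cont: "continuous_on UNIV f" using f by (rule C1_continuous)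
  have f_int: "integrable lborel f"
    using cont supp by (rule integrable_continuous_vanishing)
  have shift_int: "integrable lborel (\<lambda>x. f (x + c))" for c
  proof (rule integrable_continuous_vanishing[of _ "r + norm c"])
    show "continuous_on UNIV (\<lambda>x. f (x + c))"
      by (auto intro!: continuous_on_compose2[OF cont] continuous_intros)
    show "f (x + c) = 0" if "r + norm c < norm x" for x
      using norm_triangle_ineq4[of "x + c" c] that by (intro supp) auto
  qed
  have shift: "(\<integral>x. f (x + c) \<partial>lborel) = (\<integral>x. f x \<partial>lborel)" for c
  proof -
    have "(\<integral>x. f x \<partial>distr lborel borel ((+) c)) = (\<integral>x. f (c + x) \<partial>lborel)"
      by (rule integral_distr) (use f_int in auto)
    then show ?thesis by (simp add: lborel_distr_plus add.commute)
  qed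
  have zero: "(\<integral>x. h n x \<partial>lborel) = 0" for n
    unfolding h_def by (simp add: shift shift_int f_int)
  \<comment> \<open>A step has length at most 1: the quotient vanishes once \<open>norm x > r + 1\<close>, and for the other
      \<open>x\<close> the intermediate points stay in the ball of radius \<open>r + 2\<close>, where \<open>M\<close> bounds the gradient.\<close>
  have bound: "norm (h n x) \<le> indicator (cball 0 (r + 1)) x *\<^sub>R M" for n x
  proof (cases "norm x \<le> r + 1")
    case True
    let ?t = "inverse (real (Suc n))"
    have t: "0 < ?t" "?t \<le> 1" by (auto simp: field_simps)
    obtain z where z: "0 < z" "z < ?t" "F x ?t - F x 0 = (?t - 0) * (gradient f (x + z *\<^sub>R b) \<bullet> b)"
      using MVT2[OF t(1), of "F x" "\<lambda>t. gradient f (x + t *\<^sub>R b) \<bullet> b"] F by blast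
    then have "h n x = gradient f (x + z *\<^sub>R b) \<bullet> b"
      using t by (simp add: h_def F_def)
    moreover have "norm (x + z *\<^sub>R b) \<le> r + 2"
      using norm_triangle_ineq[of x "z *\<^sub>R b"] True z t b by auto
    then have "\<bar>gradient f (x + z *\<^sub>R b) \<bullet> b\<bar> \<le> M"
      using M(1) Basis_le_norm[OF b] order_trans by blast
    ultimately show ?thesis using True by simp
  next
    case False
    let ?t = "inverse (real (Suc n))"
    have "norm (?t *\<^sub>R b) \<le> 1" using b by (simp add: field_simps)
    then have "r < norm (x + ?t *\<^sub>R b)"
      using norm_triangle_ineq4[of "x + ?t *\<^sub>R b" "?t *\<^sub>R b"] False by auto
    then show ?thesis using False by (simp add: h_def supp)
  qed
  have lim: "(\<lambda>n. h n x) \<longlonglongrightarrow> gradient f x \<bullet> b" for x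
  proof -
    have "((\<lambda>t. (F x (0 + t) - F x 0) / t) \<longlongrightarrow> gradient f x \<bullet> b) (at 0)"
      using F[of x 0] by (simp add: DERIV_def)
    moreover have "filterlim (\<lambda>n. inverse (real (Suc n))) (at 0) sequentially"
      using LIMSEQ_inverse_real_of_nat by (simp add: filterlim_at)
    ultimately have "(\<lambda>n. (F x (0 + inverse (real (Suc n))) - F x 0) / inverse (real (Suc n)))
        \<longlonglongrightarrow> gradient f x \<bullet> b"
      by (rule filterlim_compose)
    then show ?thesis by (simp add: h_def F_def)
  qed
  have "(\<lambda>n. \<integral>x. h n x \<partial>lborel) \<longlonglongrightarrow> (\<integral>x. gradient f x \<bullet> b \<partial>lborel)"
  proof (rule integral_dominated_convergence)
    show "integrable lborel (\<lambda>x. indicator (cball 0 (r + 1)) (x::'a) *\<^sub>R M)"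
      by (rule borel_integrable_compact) auto
    show "(\<lambda>x. gradient f x \<bullet> b) \<in> borel_measurable lborel"
      using f by (auto intro!: borel_measurable_continuous_onI continuous_intros C1_continuous_gradient)
    show "h n \<in> borel_measurable lborel" for n
      unfolding h_def[abs_def]
      using f_int shift_int[of "inverse (real (Suc n)) *\<^sub>R b", THEN borel_measurable_integrable]
      by measurable
  qed (use bound lim in auto)
  then have "(\<lambda>n. 0) \<longlonglongrightarrow> (\<integral>x. gradient f x \<bullet> b \<partial>lborel)" by (simp add: zero)
  then show ?thesis by (simp add: LIMSEQ_const_iff)
qed

lemma continuous_on_laplacian:
  assumes "C2 u"
  shows "continuous_on UNIV (laplacian u)"
  using assms unfolding C2_def C1_def laplacian_def[abs_def] by (auto intro!: continuous_intros)

text \<open>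
  Green's formula without boundary term. It is the previous lemma applied to
  \<open>\<psi> \<cdot> \<partial>\<^sub>b u\<close> and summed over \<open>b\<close>, that is, the divergence theorem for
  \<open>\<psi> \<nabla>u\<close>.
\<close>
lemma integral_laplacian_mult:
  fixes u :: "'a::euclidean_space \<Rightarrow> real"
  assumes u: "C2 u" and psi: "C1 \<psi>" and supp: "\<And>x. r < norm x \<Longrightarrow> \<psi> x = 0"
  shows "(\<integral>x. - laplacian u x * \<psi> x \<partial>lborel) = (\<integral>x. gradient u x \<bullet> gradient \<psi> x \<partial>lborel)"
proof -
  let ?d = "\<lambda>b. partial_deriv b u"
  have C1: "C1 u" "\<And>b. b \<in> Basis \<Longrightarrow> C1 (?d b)" using u by (auto simp: C2_def)
  have C1f: "C1 (\<lambda>x. ?d b x * \<psi> x)" if "b \<in> Basis" for b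
    using that by (intro C1_mult C1 psi)
  have suppf: "?d b x * \<psi> x = 0" if "r < norm x" for b x using supp that by simp
  have grad: "gradient (\<lambda>x. ?d b x * \<psi> x) x \<bullet> b
      = partial_deriv b u x * partial_deriv b \<psi> x + \<psi> x * partial_deriv b (?d b) x"
    if "b \<in> Basis" for b x
    using that by (simp add: gradient_mult C1 psi inner_add_left gradient_inner_Basis)
  have "gradient u x \<bullet> gradient \<psi> x + laplacian u x * \<psi> x
      = (\<Sum>b\<in>Basis. gradient (\<lambda>x. ?d b x * \<psi> x) x \<bullet> b)" for x
  proof -
    have "gradient u x \<bullet> gradient \<psi> x = (\<Sum>b\<in>Basis. ?d b x * partial_deriv b \<psi> x)"
      by (subst euclidean_inner) (simp add: gradient_inner_Basis)
    then show ?thesis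
      by (simp add: grad laplacian_def sum.distrib sum_distrib_left mult.commute[of _ "\<psi> x"]
          cong: sum.cong)
  qed
  then have "(\<integral>x. gradient u x \<bullet> gradient \<psi> x + laplacian u x * \<psi> x \<partial>lborel)
      = (\<integral>x. (\<Sum>b\<in>Basis. gradient (\<lambda>x. ?d b x * \<psi> x) x \<bullet> b) \<partial>lborel)" by simp
  also have "\<dots> = (\<Sum>b\<in>Basis. \<integral>x. gradient (\<lambda>x. ?d b x * \<psi> x) x \<bullet> b \<partial>lborel)"
  proof (rule Bochner_Integration.integral_sum)
    fix b :: 'a assume b: "b \<in> Basis"
    show "integrable lborel (\<lambda>x. gradient (\<lambda>x. ?d b x * \<psi> x) x \<bullet> b)"
      by (rule integrable_continuous_vanishing[of _ r])
        (auto intro!: continuous_intros C1_continuous_gradient C1f b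
          simp: gradient_eq_0_outside[OF C1f[OF b] suppf])
  qed
  also have "\<dots> = 0"
    by (intro sum.neutral ballI integral_partial_deriv_eq_0[OF C1f suppf])
  finally have *: "(\<integral>x. gradient u x \<bullet> gradient \<psi> x + laplacian u x * \<psi> x \<partial>lborel) = 0" .
  have "integrable lborel (\<lambda>x. gradient u x \<bullet> gradient \<psi> x)"
    by (rule integrable_continuous_vanishing[of _ r])
      (auto intro!: continuous_intros C1_continuous_gradient C1 psi
        simp: gradient_eq_0_outside[OF psi supp])
  moreover have "integrable lborel (\<lambda>x. laplacian u x * \<psi> x)"
    by (rule integrable_continuous_vanishing[of _ r])
      (auto intro!: continuous_intros continuous_on_laplacian u C1_continuous[OF psi] simp: supp)
  ultimately show ?thesis using * by simp
qed

section \<open>The energy estimate for stable solutions\<close>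

text \<open>
  The algebra of Farina's estimate. \<open>I\<close> stands for \<open>\<integral> \<rho> u\<^bsup>p+2s-1\<^esup> \<eta>\<^sup>2\<close>, \<open>G\<close> for
  \<open>\<integral> u\<^bsup>2s-2\<^esup> \<eta>\<^sup>2 |\<nabla>u|\<^sup>2\<close>, \<open>X\<close> for the mixed term
  \<open>\<integral> u\<^bsup>2s-1\<^esup> \<eta> \<nabla>u \<cdot> \<nabla>\<eta>\<close>, and \<open>K\<close> for
  \<open>\<integral> u\<^bsup>2s\<^esup> |\<nabla>\<eta>|\<^sup>2\<close>. Eliminating \<open>G\<close> between the stability
  inequality \<open>stab\<close> and the equation \<open>weak\<close> leaves
  \<open>D I \<le> 2s(s-1) X + (2s-1) K\<close>; the mixed term is then absorbed by Young's
  inequality \<open>cs\<close>.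
\<close>
lemma absorb_energies:
  fixes p s I G X K :: real
  assumes s: "s > 1" and D: "D = p * (2 * s - 1) - s\<^sup>2" "D > 0"
    and stab: "p * I \<le> s\<^sup>2 * G + 2 * s * X + K"
    and weak: "I = (2 * s - 1) * G + 2 * X"
    and cs: "\<And>\<epsilon>. \<epsilon> > 0 \<Longrightarrow> 2 * \<bar>X\<bar> \<le> \<epsilon> * G + K / \<epsilon>"
  shows "I \<le> (1 + 2 * s\<^sup>2 * (s - 1) / D\<^sup>2 + 2 * (2 * s - 1) / D) * K"
proof -
  \<comment> \<open>\<open>cs\<close> with \<open>\<epsilon> = 1\<close> controls \<open>G\<close> by \<open>I\<close> and \<open>K\<close>. Below, \<open>\<epsilon> = D / s\<close> makes the \<open>G\<close>-part of
      the mixed term at most half of \<open>D I\<close>, up to a multiple of \<open>K\<close>.\<close>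
  have "(2 * s - 2) * G \<le> I + K"
    using cs[of 1] unfolding weak by (simp add: algebra_simps)
  then have "D / 2 * ((2 * s - 2) * G) \<le> D / 2 * (I + K)"
    using D(2) by (intro mult_left_mono) auto
  also have "D / 2 * ((2 * s - 2) * G) = s * (s - 1) * (D / s * G)"
    using s by (simp add: field_simps)
  finally have G: "s * (s - 1) * (D / s * G) \<le> D / 2 * (I + K)" .
  have "D * I = (2 * s - 1) * (p * I) - s\<^sup>2 * I"
    by (simp add: D(1) algebra_simps)
  also have "\<dots> \<le> (2 * s - 1) * (s\<^sup>2 * G + 2 * s * X + K) - s\<^sup>2 * I"
    using stab s by simp
  also have "\<dots> = s * (s - 1) * (2 * X) + (2 * s - 1) * K"
    unfolding weak by (simp add: algebra_simps power2_eq_square)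
  also have "\<dots> \<le> s * (s - 1) * (D / s * G + K / (D / s)) + (2 * s - 1) * K"
    using cs[of "D / s"] s D(2) by (intro add_right_mono mult_left_mono) auto
  also have "\<dots> \<le> D / 2 * (I + K) + s\<^sup>2 * (s - 1) / D * K + (2 * s - 1) * K"
    using G by (simp add: algebra_simps power2_eq_square)
  also have "D / 2 * (I + K) = D * I / 2 + D * K / 2"
    by (simp add: algebra_simps)
  finally have "D * I \<le> D * I / 2 + D * K / 2 + s\<^sup>2 * (s - 1) / D * K + (2 * s - 1) * K" .
  moreover have "a \<le> a / 2 + b / 2 + c + d \<Longrightarrow> a \<le> b + 2 * (c + d)" for a b c d :: real
    by simp
  ultimately have "D * I \<le> D * K + 2 * (s\<^sup>2 * (s - 1) / D * K + (2 * s - 1) * K)"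
    by blast
  also have "\<dots> = D * ((1 + 2 * s\<^sup>2 * (s - 1) / D\<^sup>2 + 2 * (2 * s - 1) / D) * K)"
    using D(2) by (simp add: field_simps power2_eq_square)
  finally show ?thesis using D(2) by simp
qed

text \<open>
  The constant does not depend on \<open>\<eta>\<close>, which is what allows the scale of the cutoff to tend to
  infinity. The two inputs of the previous lemma come from the test function
  \<open>u\<^sup>s \<eta>\<close> in the stability inequality and from the multiplier
  \<open>u\<^bsup>2s-1\<^esup> \<eta>\<^sup>2\<close> in the equation.
\<close>
lemma stable_energy_estimate:
  fixes u :: "'a::euclidean_space \<Rightarrow> real"
  assumes st: "stable_solution \<rho> p u" and rho: "continuous_on UNIV \<rho>"
    and s: "s > 1" and D: "D = p * (2 * s - 1) - s\<^sup>2" "D > 0"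
    and eta: "C1 \<eta>" and supp: "\<And>x. r < norm x \<Longrightarrow> \<eta> x = 0"
  shows "(\<integral>x. \<rho> x * u x powr (p + 2 * s - 1) * (\<eta> x)\<^sup>2 \<partial>lborel)
     \<le> (1 + 2 * s\<^sup>2 * (s - 1) / D\<^sup>2 + 2 * (2 * s - 1) / D)
         * (\<integral>x. u x powr (2 * s) * (norm (gradient \<eta> x))\<^sup>2 \<partial>lborel)"
proof -
  have u2: "C2 u" and pos: "\<And>x. u x > 0"
    and eq: "\<And>x. - laplacian u x = \<rho> x * u x powr p"
    using st by (auto simp: stable_solution_def classical_solution_def)
  have u: "C1 u" using u2 by (simp add: C2_def)
  define i where "i x = \<rho> x * u x powr (p + 2 * s - 1) * (\<eta> x)\<^sup>2" for x
  define g where "g x = u x powr (2 * s - 2) * (\<eta> x)\<^sup>2 * (norm (gradient u x))\<^sup>2" for x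
  define c where "c x = u x powr (2 * s - 1) * \<eta> x * (gradient u x \<bullet> gradient \<eta> x)" for x
  define k where "k x = u x powr (2 * s) * (norm (gradient \<eta> x))\<^sup>2" for x
  note defs = i_def g_def c_def k_def
  have g0: "gradient \<eta> x = 0" if "r < norm x" for x
    using gradient_eq_0_outside[OF eta, of r x] supp that by simp
  have cont: "continuous_on UNIV (\<lambda>x. u x powr q)" for q
    using C1_continuous C1_powr[OF u pos] by blast
  have int: "integrable lborel i" "integrable lborel g" "integrable lborel c" "integrable lborel k"
    unfolding defs
    by (auto intro!: integrable_continuous_vanishing[of _ r] continuous_intros cont rho
          C1_continuous[OF eta] C1_continuous_gradient u eta simp: supp g0)
  have phi: "C1 (\<lambda>x. u x powr s * \<eta> x)" by (intro C1_mult C1_powr u pos eta)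
  have psi: "C1 (\<lambda>x. u x powr (2 * s - 1) * (\<eta> x * \<eta> x))" by (intro C1_mult C1_powr u pos eta)
  have "p * (\<integral>x. \<rho> x * u x powr (p - 1) * (u x powr s * \<eta> x)\<^sup>2 \<partial>lborel)
      \<le> (\<integral>x. (norm (gradient (\<lambda>x. u x powr s * \<eta> x) x))\<^sup>2 \<partial>lborel)"
    using st C1_compact_supportI[OF phi, of r] supp by (auto simp: stable_solution_def)
  also have "(\<lambda>x. \<rho> x * u x powr (p - 1) * (u x powr s * \<eta> x)\<^sup>2) = i"
    by (auto simp: i_def power_mult_distrib power2_eq_square powr_add[symmetric] algebra_simps)
  also have "(\<lambda>x. (norm (gradient (\<lambda>x. u x powr s * \<eta> x) x))\<^sup>2)
      = (\<lambda>x. s\<^sup>2 * g x + 2 * s * c x + k x)"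
  proof
    fix x
    have "u x powr (2 * s - 2) = (u x powr (s - 1))\<^sup>2"
      "u x powr (2 * s - 1) = u x powr s * u x powr (s - 1)"
      "u x powr (2 * s) = (u x powr s)\<^sup>2"
      by (simp_all add: power2_eq_square powr_add[symmetric])
    then show "(norm (gradient (\<lambda>x. u x powr s * \<eta> x) x))\<^sup>2 = s\<^sup>2 * g x + 2 * s * c x + k x"
      unfolding defs power2_norm_eq_inner gradient_mult[OF C1_powr[OF u pos] eta]
        gradient_powr[OF u pos]
      by (simp add: inner_add_left inner_add_right inner_commute power2_eq_square algebra_simps)
  qed
  finally have stab: "p * (\<integral>x. i x \<partial>lborel)
      \<le> s\<^sup>2 * (\<integral>x. g x \<partial>lborel) + 2 * s * (\<integral>x. c x \<partial>lborel) + (\<integral>x. k x \<partial>lborel)"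
    by (simp add: int)
  have "i = (\<lambda>x. - laplacian u x * (u x powr (2 * s - 1) * (\<eta> x * \<eta> x)))"
    by (auto simp: i_def eq power2_eq_square powr_add[symmetric] algebra_simps)
  then have "(\<integral>x. i x \<partial>lborel)
      = (\<integral>x. gradient u x \<bullet> gradient (\<lambda>x. u x powr (2 * s - 1) * (\<eta> x * \<eta> x)) x \<partial>lborel)"
    using integral_laplacian_mult[OF u2 psi, of r] supp by simp
  also have "(\<lambda>x. gradient u x \<bullet> gradient (\<lambda>x. u x powr (2 * s - 1) * (\<eta> x * \<eta> x)) x)
      = (\<lambda>x. (2 * s - 1) * g x + 2 * c x)"
  proof
    fix x
    show "gradient u x \<bullet> gradient (\<lambda>x. u x powr (2 * s - 1) * (\<eta> x * \<eta> x)) x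
        = (2 * s - 1) * g x + 2 * c x"
      unfolding defs power2_norm_eq_inner
        gradient_mult[OF C1_powr[OF u pos] C1_mult[OF eta eta]] gradient_mult[OF eta eta]
        gradient_powr[OF u pos]
      by (simp add: inner_add_left inner_add_right inner_commute power2_eq_square algebra_simps)
  qed
  finally have weak: "(\<integral>x. i x \<partial>lborel) = (2 * s - 1) * (\<integral>x. g x \<partial>lborel) + 2 * (\<integral>x. c x \<partial>lborel)"
    by (simp add: int)
  have "2 * \<bar>\<integral>x. c x \<partial>lborel\<bar> \<le> \<epsilon> * (\<integral>x. g x \<partial>lborel) + (\<integral>x. k x \<partial>lborel) / \<epsilon>" if e: "\<epsilon> > 0" for \<epsilon>
  proof -
    have pt: "2 * \<bar>c x\<bar> \<le> \<epsilon> * g x + k x / \<epsilon>" for x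
    proof -
      define a where "a = u x powr (s - 1) * \<bar>\<eta> x\<bar> * norm (gradient u x)"
      define b where "b = u x powr s * norm (gradient \<eta> x)"
      have "\<bar>c x\<bar> = u x powr (2 * s - 1) * \<bar>\<eta> x\<bar> * \<bar>gradient u x \<bullet> gradient \<eta> x\<bar>"
        by (simp add: c_def abs_mult)
      also have "\<dots> \<le> u x powr (2 * s - 1) * \<bar>\<eta> x\<bar> * (norm (gradient u x) * norm (gradient \<eta> x))"
        by (intro mult_left_mono Cauchy_Schwarz_ineq2) auto
      also have "\<dots> = a * b"
        by (simp add: a_def b_def powr_add[symmetric])
      finally have "\<bar>c x\<bar> \<le> a * b" .
      moreover have "g x = a\<^sup>2" "k x = b\<^sup>2"
        by (simp_all add: g_def k_def a_def b_def power_mult_distrib)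
          (simp_all add: power2_eq_square powr_add[symmetric])
      moreover have "2 * (a * b) \<le> \<epsilon> * a\<^sup>2 + b\<^sup>2 / \<epsilon>"
      proof -
        have "0 \<le> (\<epsilon> * a - b)\<^sup>2 / \<epsilon>" using e by simp
        also have "\<dots> = \<epsilon> * a\<^sup>2 + b\<^sup>2 / \<epsilon> - 2 * (a * b)"
          using e by (simp add: field_simps power2_eq_square)
        finally show ?thesis by simp
      qed
      ultimately show ?thesis by simp
    qed
    have "2 * \<bar>\<integral>x. c x \<partial>lborel\<bar> \<le> (\<integral>x. 2 * \<bar>c x\<bar> \<partial>lborel)"
      using integral_abs_bound[of lborel c] by simp
    also have "\<dots> \<le> (\<integral>x. \<epsilon> * g x + k x / \<epsilon> \<partial>lborel)"
      using int pt by (intro integral_mono) auto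
    also have "\<dots> = \<epsilon> * (\<integral>x. g x \<partial>lborel) + (\<integral>x. k x \<partial>lborel) / \<epsilon>"
      using int by simp
    finally show ?thesis .
  qed
  from absorb_energies[OF s D stab weak this] show ?thesis unfolding defs by simp
qed

section \<open>Cutoff functions\<close>
lemma has_field_derivative_positive_part_power:
  fixes y :: real
  assumes "k \<ge> 1"
  shows "((\<lambda>y. max 0 y ^ Suc k) has_field_derivative real (Suc k) * max 0 y ^ k) (at y)"
proof (cases "y = 0")
  case True
  have "((\<lambda>h. max 0 h ^ k) \<longlongrightarrow> max 0 (0::real) ^ k) (at 0)"
    by (intro tendsto_intros)
  moreover have "max 0 (0::real) ^ k = 0" using assms by simp
  ultimately have "((\<lambda>h::real. max 0 h ^ k) \<longlongrightarrow> 0) (at 0)" by (simp only:)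
  then have "((\<lambda>h::real. (max 0 (0 + h) ^ Suc k - max 0 0 ^ Suc k) / h) \<longlongrightarrow> 0) (at 0)"
    by (rule Lim_transform_eventually)
      (use assms in \<open>auto simp: eventually_at_filter max_def\<close>)
  then show ?thesis using True assms by (simp add: DERIV_def zero_power)
next
  case False
  show ?thesis
  proof (cases "y < 0")
    case True
    have "((\<lambda>y. 0) has_field_derivative 0) (at y)" by simp
    from has_field_derivative_transform_within_open[OF this, of "{..<0}" "\<lambda>y. max 0 y ^ Suc k"]
    show ?thesis using True assms by (auto simp: max_def zero_power)
  next
    case pos: False
    have "((\<lambda>y. y ^ Suc k) has_field_derivative real (Suc k) * y ^ k) (at y)"
      using DERIV_pow[of "Suc k" y UNIV] by simp
    from has_field_derivative_transform_within_open[OF this, of "{0<..}" "\<lambda>y. max 0 y ^ Suc k"]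
    show ?thesis using pos False by (auto simp: max_def)
  qed
qed

text \<open>
  In terms of \<open>t = |x|\<^sup>2 / R\<^sup>2\<close> the cutoff is
  \<open>\<zeta> = (1 - ((t - 1)\<^sup>+)\<^sup>2)\<^sup>+\<close>. The inner square makes the transition at \<open>t = 1\<close> of class
  \<open>C\<^sup>1\<close>; at the outer edge \<open>t = 2\<close> only powers with exponent at least 2 are, whence
  \<open>\<zeta> ^ Suc k\<close>. The gradient of such a power still contains the factor \<open>\<zeta> ^ k\<close>, and this is what
  later compensates negative powers of \<open>\<zeta>\<close>.
\<close>
lemma exists_cutoff:
  fixes R :: real
  assumes R: "R > 0" and k: "k \<ge> 1"
  obtains \<zeta> :: "'a::euclidean_space \<Rightarrow> real"
  where "C1 (\<lambda>x. \<zeta> x ^ Suc k)"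
    and "\<And>x. 0 \<le> \<zeta> x" "\<And>x. \<zeta> x \<le> 1"
    and "\<And>x. norm x \<le> R \<Longrightarrow> \<zeta> x = 1"
    and "\<And>x. 2 * R < norm x \<Longrightarrow> \<zeta> x = 0"
    and "\<And>x. norm x \<le> R \<Longrightarrow> gradient (\<lambda>x. \<zeta> x ^ Suc k) x = 0"
    and "\<And>x. (norm (gradient (\<lambda>x. \<zeta> x ^ Suc k) x))\<^sup>2
              \<le> 32 * (real (Suc k))\<^sup>2 / R\<^sup>2 * \<zeta> x ^ (2 * k)"
proof
  define q where "q t = max 0 (1 - (max 0 (t - 1))\<^sup>2)" for t :: real
  define q' where "q' t = real (Suc k) * q t ^ k * - (2 * max 0 (t - 1))" for t :: real
  define T where "T x = (norm x)\<^sup>2 / R\<^sup>2" for x :: 'a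
  have dq: "((\<lambda>t. q t ^ Suc k) has_field_derivative q' t) (at t)" for t
  proof -
    have "((\<lambda>t::real. max 0 (t - 1) ^ Suc 1) has_field_derivative
        (real (Suc 1) * max 0 (t - 1) ^ 1) * 1) (at t)"
      by (rule DERIV_chain2[OF has_field_derivative_positive_part_power])
        (auto intro!: derivative_eq_intros)
    then have "((\<lambda>t::real. (max 0 (t - 1))\<^sup>2) has_field_derivative 2 * max 0 (t - 1)) (at t)"
      by (simp add: power2_eq_square)
    from DERIV_diff[OF DERIV_const this, of 1]
    have "((\<lambda>t::real. 1 - (max 0 (t - 1))\<^sup>2) has_field_derivative
        - (2 * max 0 (t - 1))) (at t)" by simp
    from DERIV_chain2[OF has_field_derivative_positive_part_power[OF k] this]
    show ?thesis by (simp add: q_def q'_def)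
  qed
  have GT: "GDERIV T x :> (2 / R\<^sup>2) *\<^sub>R x" for x
    unfolding T_def[abs_def] gderiv_def power2_norm_eq_inner
    using R by (auto intro!: derivative_eq_intros
        simp: inner_commute field_simps fun_eq_iff power2_eq_square power4_eq_xxxx)
  have T: "C1 T" "gradient T x = (2 / R\<^sup>2) *\<^sub>R x" for x
    by (auto intro!: C1I[OF GT] gradient_eqI[OF GT] continuous_intros)
  have cq': "continuous_on S q'" for S
    unfolding q'_def[abs_def] q_def by (intro continuous_intros)
  show "C1 (\<lambda>x. q (T x) ^ Suc k)"
    using C1_compose[OF T(1) dq cq'] .
  have grad: "gradient (\<lambda>x. q (T x) ^ Suc k) x = q' (T x) *\<^sub>R (2 / R\<^sup>2) *\<^sub>R x" for x
    using gradient_compose[OF T(1) dq cq'] by (simp only: T(2))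
  show "0 \<le> q (T x)" "q (T x) \<le> 1" for x by (simp_all add: q_def)
  have T1: "T x \<le> 1" if "norm x \<le> R" for x
    using that R by (simp add: T_def)
  show "q (T x) = 1" if "norm x \<le> R" for x
    using T1[OF that] by (simp add: q_def)
  show "gradient (\<lambda>x. q (T x) ^ Suc k) x = 0" if "norm x \<le> R" for x
    unfolding grad using T1[OF that] by (simp add: q'_def)
  have q0: "q t = 0" if "t \<ge> 2" for t
  proof -
    have "1\<^sup>2 \<le> (t - 1)\<^sup>2" using that by (intro power_mono) auto
    then have "1 - (max 0 (t - 1))\<^sup>2 \<le> 0" using that by (simp add: max_absorb2)
    then show ?thesis unfolding q_def by (rule max_absorb1)
  qed
  show "q (T x) = 0" if "2 * R < norm x" for x
  proof -
    have "(2 * R)\<^sup>2 \<le> (norm x)\<^sup>2" using that R by (intro power_mono) auto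
    moreover have "2 * R\<^sup>2 \<le> (2 * R)\<^sup>2" by (simp add: power_mult_distrib)
    ultimately have "2 * R\<^sup>2 \<le> (norm x)\<^sup>2" by linarith
    then show ?thesis using R by (intro q0) (simp add: T_def field_simps)
  qed
  show "(norm (gradient (\<lambda>x. q (T x) ^ Suc k) x))\<^sup>2
      \<le> 32 * (real (Suc k))\<^sup>2 / R\<^sup>2 * q (T x) ^ (2 * k)" for x
  proof (cases "T x \<ge> 2")
    case True
    then show ?thesis using k unfolding grad by (simp add: q'_def q0 zero_power)
  next
    case False
    then have m: "(max 0 (T x - 1))\<^sup>2 \<le> 1" by (intro power_le_one) auto
    have "(norm (gradient (\<lambda>x. q (T x) ^ Suc k) x))\<^sup>2 = (q' (T x))\<^sup>2 * (4 / R\<^sup>2 * T x)"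
      unfolding grad using R by (simp add: T_def power_mult_distrib power_divide field_simps)
    also have "\<dots> = (real (Suc k))\<^sup>2 * q (T x) ^ (2 * k) * (max 0 (T x - 1))\<^sup>2 * (16 / R\<^sup>2) * T x"
      by (simp only: q'_def power_mult_distrib power2_minus power_even_eq[symmetric])
        (simp add: mult.commute[of 2 k] power_mult)
    also have "\<dots> \<le> (real (Suc k))\<^sup>2 * q (T x) ^ (2 * k) * 1 * (16 / R\<^sup>2) * 2"
      using m False by (intro mult_mono) (auto simp: T_def q_def)
    finally show ?thesis by (simp add: field_simps)
  qed
qed

section \<open>Decay of the weighted integral\<close>

text \<open>
  This takes the place of the Hoelder and Young inequalities, at a single point: \<open>U\<close> is the
  value of \<open>u\<close>, \<open>z ^ Suc k\<close> that of \<open>\<eta>\<close>, and \<open>g\<close> that of \<open>|\<nabla>\<eta>|\<^sup>2\<close>. If the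
  left-hand side exceeds the first summand on the right, then \<open>B U\<^bsup>p-1\<^esup> z\<^sup>2 \<le> 2 C \<kappa>\<close>, so
  \<open>U\<^bsup>2s\<^esup>\<close> is at most \<open>(2 C \<kappa> / B)\<^sup>\<tau> z\<^bsup>-2\<tau>\<^esup>\<close> with
  \<open>\<tau> = 2s/(p-1)\<close>, and the factor \<open>z\<^bsup>2k\<^esup>\<close> in \<open>g\<close> cancels the negative power of
  \<open>z\<close> because \<open>k \<ge> \<tau>\<close>.
\<close>
lemma gradient_term_dichotomy:
  fixes U :: real
  assumes p: "p > 1" and s: "s > 0" and C: "C > 0" and B: "B > 0" "B \<le> \<rho>" and U: "U > 0"
    and z: "0 \<le> z" "z \<le> 1" and k: "k \<ge> 1" "2 * s / (p - 1) \<le> real k"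
    and \<kappa>: "\<kappa> > 0" and g: "g \<le> \<kappa> * z ^ (2 * k)"
  shows "C * (U powr (2 * s) * g) \<le> 1 / 2 * (\<rho> * U powr (p + 2 * s - 1) * (z ^ Suc k)\<^sup>2)
           + C * \<kappa> * (2 * C * \<kappa> / B) powr (2 * s / (p - 1))" (is "?L \<le> 1 / 2 * ?M + ?E")
proof (cases "?L \<le> 1 / 2 * ?M")
  case True
  moreover have "0 \<le> ?E" using C \<kappa> by simp
  ultimately show ?thesis by simp
next
  case False
  define \<tau> where "\<tau> = 2 * s / (p - 1)"
  have M: "0 \<le> ?M" using B by simp
  have L: "?L \<le> C * (U powr (2 * s) * (\<kappa> * z ^ (2 * k)))"
    using g C by (intro mult_left_mono) auto
  have "z \<noteq> 0"
  proof
    assume "z = 0"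
    then have "z ^ (2 * k) = 0" using k(1) by simp
    then have "?L \<le> 0" using L by (simp only: mult_zero_right)
    then show False using False M by simp
  qed
  then have z0: "z > 0" using z by simp
  have "B * U powr (p - 1) * z\<^sup>2 * (U powr (2 * s) * z ^ (2 * k))
      \<le> \<rho> * U powr (p - 1) * z\<^sup>2 * (U powr (2 * s) * z ^ (2 * k))"
    using B z0 by (intro mult_right_mono) auto
  also have "\<dots> = ?M"
  proof -
    have "U powr (p + 2 * s - 1) = U powr (p - 1) * U powr (2 * s)"
      by (simp add: powr_add[symmetric] algebra_simps)
    moreover have "(z ^ Suc k)\<^sup>2 = z\<^sup>2 * z ^ (2 * k)"
      by (simp add: power_mult_distrib power_mult[symmetric] mult.commute)
    ultimately show ?thesis by simp
  qed
  also have "?M \<le> 2 * ?L"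
    using False by linarith
  also have "\<dots> \<le> 2 * (C * (U powr (2 * s) * (\<kappa> * z ^ (2 * k))))"
    using L by linarith
  also have "\<dots> = 2 * C * \<kappa> * (U powr (2 * s) * z ^ (2 * k))"
    by simp
  finally have "B * U powr (p - 1) * z\<^sup>2 \<le> 2 * C * \<kappa>"
    using U z0 by simp
  then have "U powr (p - 1) \<le> 2 * C * \<kappa> / B / z\<^sup>2"
    using B z0 by (simp add: field_simps)
  then have "(U powr (p - 1)) powr \<tau> \<le> (2 * C * \<kappa> / B / z\<^sup>2) powr \<tau>"
    using p s by (intro powr_mono2) (auto simp: \<tau>_def)
  moreover have "(U powr (p - 1)) powr \<tau> = U powr (2 * s)"
    using p by (simp add: powr_powr \<tau>_def)
  moreover have "(2 * C * \<kappa> / B / z\<^sup>2) powr \<tau> = (2 * C * \<kappa> / B) powr \<tau> * z powr (- 2 * \<tau>)"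
  proof -
    have "(z\<^sup>2) powr \<tau> = z powr (2 * \<tau>)"
      using z0 by (simp add: powr_powr flip: powr_numeral)
    moreover have "(2 * C * \<kappa> / B / z\<^sup>2) powr \<tau> = (2 * C * \<kappa> / B) powr \<tau> / (z\<^sup>2) powr \<tau>"
      by (rule powr_divide)
    ultimately show ?thesis by (simp add: powr_minus_divide)
  qed
  ultimately have Us: "U powr (2 * s) \<le> (2 * C * \<kappa> / B) powr \<tau> * z powr (- 2 * \<tau>)"
    by simp
  have "z powr (- 2 * \<tau>) * z ^ (2 * k) = z powr (2 * (real k - \<tau>))"
    using z0 by (simp add: powr_realpow[symmetric] powr_add[symmetric] algebra_simps)
  also have "\<dots> \<le> 1"
    using z z0 k(2) by (intro powr_le1) (auto simp: \<tau>_def)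
  finally have zz: "z powr (- 2 * \<tau>) * z ^ (2 * k) \<le> 1" .
  have "?L \<le> C * ((2 * C * \<kappa> / B) powr \<tau> * z powr (- 2 * \<tau>) * (\<kappa> * z ^ (2 * k)))"
    using L Us C \<kappa> z0 by (elim order_trans) (intro mult_left_mono mult_right_mono, auto)
  also have "\<dots> = ?E * (z powr (- 2 * \<tau>) * z ^ (2 * k))" by (simp add: \<tau>_def)
  also have "\<dots> \<le> ?E * 1" using zz C \<kappa> by (intro mult_left_mono) auto
  finally show ?thesis using M by simp
qed

text \<open>
  The growth of \<open>\<rho>\<close> enters through \<open>\<rho> \<ge> A R\<^sup>\<alpha>\<close> on the annulus where the
  gradient of the cutoff lives, and improves the exponent of \<open>R\<close> from
  \<open>N - 2 - 2\<tau>\<close> to \<open>N - 2 - (2 + \<alpha>)\<tau>\<close>, where \<open>\<tau> = 2s/(p-1)\<close>.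
\<close>
theorem no_stable_solution:
  fixes \<rho> :: "'a::euclidean_space \<Rightarrow> real"
  assumes \<alpha>: "\<alpha> \<ge> 0" and A: "A > 0" and rho: "continuous_on UNIV \<rho>"
    and lower: "\<And>x. \<rho> x \<ge> A * (1 + (norm x)\<^sup>2) powr (\<alpha> / 2)"
    and p: "p > 1"
    and dim: "real DIM('a) < 2 + 2 * (2 + \<alpha>) / (p - 1) * (p + sqrt (p\<^sup>2 - p))"
  shows "\<not> stable_solution \<rho> p u"
proof
  assume st: "stable_solution \<rho> p u"
  then have u: "C1 u" and pos: "\<And>x. u x > 0"
    by (auto simp: stable_solution_def classical_solution_def C2_def)
  have rho_pos: "\<rho> x > 0" for x
  proof -
    have "0 < 1 + (norm x)\<^sup>2" by (simp add: add_pos_nonneg)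
    then have "0 < A * (1 + (norm x)\<^sup>2) powr (\<alpha> / 2)" using A by simp
    then show ?thesis using lower[of x] by linarith
  qed
  have pp: "p\<^sup>2 - p > 0" using p by (simp add: power2_eq_square)
  \<comment> \<open>The choice of \<open>s\<close>: the second entry of the maximum makes the final exponent of \<open>R\<close> negative, the
      upper bound makes \<open>p * (2 * s - 1) - s\<^sup>2\<close> positive, since this equals \<open>(p\<^sup>2 - p) - (s - p)\<^sup>2\<close>.\<close>
  have "max p ((real DIM('a) - 2) * (p - 1) / (2 * (2 + \<alpha>))) < p + sqrt (p\<^sup>2 - p)"
    using dim pp p \<alpha> by (simp add: field_simps)
  then obtain s where s: "p < s" "(real DIM('a) - 2) * (p - 1) / (2 * (2 + \<alpha>)) < s"
      "s < p + sqrt (p\<^sup>2 - p)"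
    using dense by (metis max_less_iff_conj)
  have s1: "s > 1" using s p by simp
  define D where "D = p * (2 * s - 1) - s\<^sup>2"
  have "(s - p)\<^sup>2 < (sqrt (p\<^sup>2 - p))\<^sup>2" using s by (intro power_strict_mono) auto
  then have D: "D > 0" using pp by (simp add: D_def power2_eq_square algebra_simps)
  define C where "C = 1 + 2 * s\<^sup>2 * (s - 1) / D\<^sup>2 + 2 * (2 * s - 1) / D"
  have C: "C > 0" using s1 D by (simp add: C_def add_pos_nonneg)
  define \<tau> where "\<tau> = 2 * s / (p - 1)"
  have \<tau>: "\<tau> > 0" using s1 p by (simp add: \<tau>_def)
  have e: "real DIM('a) - 2 - (2 + \<alpha>) * \<tau> < 0"
    using s(2) p \<alpha> by (simp add: \<tau>_def field_simps)
  define k where "k = max 1 (nat \<lceil>\<tau>\<rceil>)"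
  have k: "k \<ge> 1" "\<tau> \<le> real k" by (auto simp: k_def) linarith
  define c where "c = 32 * (real (Suc k))\<^sup>2"
  have c: "c > 0" by (simp add: c_def)
  define w where "w x = \<rho> x * u x powr (p + 2 * s - 1)" for x
  have w_cont: "continuous_on UNIV w" and w_pos: "w x > 0" for x
    unfolding w_def[abs_def] using rho_pos[of x] pos[of x]
    by (auto intro!: continuous_on_mult rho C1_continuous[OF C1_powr[OF u pos]])
  have "\<exists>x\<in>cball 0 1. \<forall>y\<in>cball 0 1. w x \<le> w y"
    by (rule continuous_attains_inf) (auto intro: continuous_on_subset[OF w_cont])
  then obtain x0 where "\<forall>x\<in>cball 0 1. w x0 \<le> w x" by blast
  then obtain \<mu> where \<mu>: "\<mu> > 0" "\<And>x. norm x \<le> 1 \<Longrightarrow> \<mu> \<le> w x"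
    by (intro that[of "w x0"]) (use w_pos in auto)
  define V where "V = unit_ball_vol (real DIM('a))"
  define L where "L = 2 * (C * c * (2 * C * c / A) powr \<tau>) * (V * 2 ^ DIM('a))"
  have ball_int: "integrable lborel (indicat_real (cball (0::'a) r))" for r
    using borel_integrable_compact[of "cball (0::'a) r" "\<lambda>_. 1::real"] by simp
  have key: "\<mu> * V \<le> L * R powr (real DIM('a) - 2 - (2 + \<alpha>) * \<tau>)" if R: "R \<ge> 1" for R
  proof -
    have R0: "R > 0" using R by simp
    obtain \<zeta> :: "'a \<Rightarrow> real" where eta: "C1 (\<lambda>x. \<zeta> x ^ Suc k)"
      and \<zeta>: "\<And>x. 0 \<le> \<zeta> x" "\<And>x. \<zeta> x \<le> 1"
      and in_R: "\<And>x. norm x \<le> R \<Longrightarrow> \<zeta> x = 1" "\<And>x. norm x \<le> R \<Longrightarrow> gradient (\<lambda>x. \<zeta> x ^ Suc k) x = 0"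
      and out_R: "\<And>x. 2 * R < norm x \<Longrightarrow> \<zeta> x = 0"
      and grad: "\<And>x. (norm (gradient (\<lambda>x. \<zeta> x ^ Suc k) x))\<^sup>2 \<le> c / R\<^sup>2 * \<zeta> x ^ (2 * k)"
      using exists_cutoff[OF R0 k(1)] unfolding c_def by metis
    define \<eta> where "\<eta> x = \<zeta> x ^ Suc k" for x
    have eta1: "C1 \<eta>" using eta by (simp add: \<eta>_def[abs_def])
    have supp: "\<eta> x = 0" if "2 * R < norm x" for x using out_R[OF that] by (simp add: \<eta>_def)
    define E where "E = C * (c / R\<^sup>2) * (2 * C * (c / R\<^sup>2) / (A * R powr \<alpha>)) powr \<tau>"
    define I where "I = (\<integral>x. w x * (\<eta> x)\<^sup>2 \<partial>lborel)"
    have E0: "E \<ge> 0" using C c by (simp add: E_def)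
    have int_w: "integrable lborel (\<lambda>x. w x * (\<eta> x)\<^sup>2)"
      by (rule integrable_continuous_vanishing[of _ "2 * R"])
        (auto intro!: continuous_intros w_cont C1_continuous[OF eta1] simp: supp)
    have int_k: "integrable lborel (\<lambda>x. u x powr (2 * s) * (norm (gradient \<eta> x))\<^sup>2)"
      by (rule integrable_continuous_vanishing[of _ "2 * R"])
        (auto intro!: continuous_intros C1_continuous[OF C1_powr[OF u pos]] C1_continuous_gradient eta1
          simp: gradient_eq_0_outside[OF eta1 supp])
    have pt: "C * (u x powr (2 * s) * (norm (gradient \<eta> x))\<^sup>2)
        \<le> 1 / 2 * (w x * (\<eta> x)\<^sup>2) + E * indicator (cball 0 (2 * R)) x" for x
    proof (cases "R < norm x \<and> norm x \<le> 2 * R")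
      case True
      have "A * R powr \<alpha> = A * (R\<^sup>2) powr (\<alpha> / 2)"
        using R0 by (simp add: powr_numeral[symmetric] powr_powr del: powr_numeral)
      also have "\<dots> \<le> A * (1 + (norm x)\<^sup>2) powr (\<alpha> / 2)"
      proof (intro mult_left_mono powr_mono2)
        have "R\<^sup>2 \<le> (norm x)\<^sup>2" using True R0 by (intro power_mono) auto
        then show "R\<^sup>2 \<le> 1 + (norm x)\<^sup>2" by simp
      qed (use \<alpha> A in auto)
      finally have B: "A * R powr \<alpha> \<le> \<rho> x" using lower[of x] by simp
      have "C * (u x powr (2 * s) * (norm (gradient \<eta> x))\<^sup>2)
          \<le> 1 / 2 * (\<rho> x * u x powr (p + 2 * s - 1) * (\<zeta> x ^ Suc k)\<^sup>2) + E"
        unfolding E_def \<tau>_def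
        by (rule gradient_term_dichotomy)
          (use p s1 C A R0 B pos \<zeta> k c grad in \<open>auto simp: \<tau>_def \<eta>_def[abs_def]\<close>)
      then show ?thesis using True by (simp add: w_def \<eta>_def)
    next
      case False
      then have "gradient \<eta> x = 0"
        using in_R(2)[of x] gradient_eq_0_outside[OF eta1, of "2 * R" x] supp
        by (fastforce simp: \<eta>_def[abs_def])
      then show ?thesis using E0 w_pos[of x] by simp
    qed
    have "I \<le> C * (\<integral>x. u x powr (2 * s) * (norm (gradient \<eta> x))\<^sup>2 \<partial>lborel)"
      using stable_energy_estimate[OF st rho s1 D_def D eta1 supp]
      by (simp add: I_def w_def C_def)
    also have "\<dots> = (\<integral>x. C * (u x powr (2 * s) * (norm (gradient \<eta> x))\<^sup>2) \<partial>lborel)"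
      by simp
    also have "\<dots> \<le> (\<integral>x. 1 / 2 * (w x * (\<eta> x)\<^sup>2) + E * indicator (cball 0 (2 * R)) x \<partial>lborel)"
      by (intro integral_mono pt Bochner_Integration.integrable_add integrable_mult_right
          int_w int_k ball_int)
    also have "\<dots> = 1 / 2 * I + E * (V * (2 * R) ^ DIM('a))"
      using int_w ball_int R0 by (simp add: I_def V_def content_cball)
    finally have "I \<le> 2 * E * (V * (2 * R) ^ DIM('a))" by simp
    also have "\<dots> = L * R powr (real DIM('a) - 2 - (2 + \<alpha>) * \<tau>)"
    proof -
      have "R powr (- (2 + \<alpha>)) = 1 / (R\<^sup>2 * R powr \<alpha>)"
        unfolding powr_minus_divide using R0 by (simp add: powr_add)
      then have "2 * C * (c / R\<^sup>2) / (A * R powr \<alpha>) = 2 * C * c / A * R powr (- (2 + \<alpha>))"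
        by simp
      then have "(2 * C * (c / R\<^sup>2) / (A * R powr \<alpha>)) powr \<tau>
          = (2 * C * c / A) powr \<tau> * R powr (- (2 + \<alpha>) * \<tau>)"
        by (simp only: powr_mult[of "2 * C * c / A"] powr_powr)
      moreover have "R powr (real DIM('a) - 2 - (2 + \<alpha>) * \<tau>)
          = R ^ DIM('a) / R\<^sup>2 * R powr (- (2 + \<alpha>) * \<tau>)"
        using R0 by (simp add: powr_diff powr_minus powr_add powr_realpow field_simps)
      ultimately show ?thesis
        by (simp add: L_def E_def power_mult_distrib)
    qed
    finally have upper: "I \<le> L * R powr (real DIM('a) - 2 - (2 + \<alpha>) * \<tau>)" .
    have "\<mu> * V = (\<integral>x. \<mu> * indicator (cball (0::'a) 1) x \<partial>lborel)"
      by (simp add: V_def content_cball)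
    also have "\<dots> \<le> I"
      unfolding I_def
    proof (intro integral_mono integrable_mult_right ball_int int_w)
      fix x :: 'a
      show "\<mu> * indicator (cball 0 1) x \<le> w x * (\<eta> x)\<^sup>2"
        using \<mu>(2)[of x] w_pos[of x] in_R(1)[of x] R by (auto simp: indicator_def \<eta>_def less_imp_le)
    qed
    finally show ?thesis using upper by simp
  qed
  have "((\<lambda>R. L * R powr (real DIM('a) - 2 - (2 + \<alpha>) * \<tau>)) \<longlongrightarrow> L * 0) at_top"
    using e by (intro tendsto_mult tendsto_const tendsto_neg_powr filterlim_ident)
  moreover have "\<forall>\<^sub>F R in at_top. \<mu> * V \<le> L * R powr (real DIM('a) - 2 - (2 + \<alpha>) * \<tau>)"
    using key by (auto intro: eventually_mono[OF eventually_ge_at_top[of 1]])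
  ultimately have "\<mu> * V \<le> L * 0"
    by (rule tendsto_lowerbound) simp
  moreover have "\<mu> * V > 0" using \<mu>(1) by (simp add: V_def)
  ultimately show False by simp
qed

text \<open>
  Since \<open>10 + 4\<alpha> = 2 + 2(2+\<alpha>) \<cdot> 2\<close>, it suffices that
  \<open>(p + \<surd>(p\<^sup>2-p)) / (p - 1) > 2\<close>, which is equivalent to \<open>\<surd>(p\<^sup>2-p) > p - 2\<close>.
\<close>
lemma condition_of_dim_le:
  fixes N \<alpha> p :: real
  assumes "\<alpha> \<ge> 0" "p > 1" "N \<le> 10 + 4 * \<alpha>"
  shows "N < 2 + 2 * (2 + \<alpha>) / (p - 1) * (p + sqrt (p\<^sup>2 - p))"
proof -
  have "p - 2 < sqrt (p\<^sup>2 - p)"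
  proof (cases "p \<ge> 2")
    case True
    then show ?thesis by (intro real_less_rsqrt) (simp add: power2_eq_square algebra_simps)
  next
    case False
    have "0 \<le> p\<^sup>2 - p" using assms(2) by (simp add: power2_eq_square)
    then show ?thesis using False real_sqrt_ge_zero[of "p\<^sup>2 - p"] by linarith
  qed
  then have "2 < (p + sqrt (p\<^sup>2 - p)) / (p - 1)" using assms(2) by (simp add: field_simps)
  then have "2 * (2 + \<alpha>) * 2 < 2 * (2 + \<alpha>) * ((p + sqrt (p\<^sup>2 - p)) / (p - 1))"
    using assms(1) by (intro mult_strict_left_mono) auto
  then show ?thesis using assms(3) by simp
qed

theorem corollary1p1:
  fixes \<rho> :: "real ^ 'n \<Rightarrow> real" and \<alpha> A :: real
  assumes "\<alpha> \<ge> 0" and "A > 0"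
    and "radial \<rho>" and "continuous_on UNIV \<rho>"
    and "\<And>x. \<rho> x \<ge> A * (1 + (norm x)\<^sup>2) powr (\<alpha> / 2)"
  shows
    "(\<forall>p::real. p > 4 / 3 \<and>
         real CARD('n) < 2 + 2 * (2 + \<alpha>) / (p - 1) * (p + sqrt (p\<^sup>2 - p)) \<longrightarrow>
         \<not> (\<exists>u. stable_solution \<rho> p u)) \<and>
     (real CARD('n) \<le> 10 + 4 * \<alpha> \<longrightarrow>
         (\<forall>p::real. p > 4 / 3 \<longrightarrow> \<not> (\<exists>u. stable_solution \<rho> p u))) \<and>
     (\<forall>p::real. 1 < p \<and> p \<le> 4 / 3 \<and>
         real CARD('n) < 2 + 2 * (2 + \<alpha>) / (p - 1) * (p + sqrt (p\<^sup>2 - p)) \<longrightarrow>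
         \<not> (\<exists>u. stable_solution \<rho> p u \<and> bounded (range u))) \<and>
     (real CARD('n) \<le> 10 + 4 * \<alpha> \<longrightarrow>
         (\<forall>p::real. p > 1 \<longrightarrow> \<not> (\<exists>u. stable_solution \<rho> p u \<and> bounded (range u))))"
proof -
  have *: "\<not> stable_solution \<rho> p u"
    if "p > 1" "real CARD('n) < 2 + 2 * (2 + \<alpha>) / (p - 1) * (p + sqrt (p\<^sup>2 - p))" for p u
    by (rule no_stable_solution[OF assms(1,2,4,5)]) (use that in auto)
  moreover have "\<not> stable_solution \<rho> p u" if "p > 1" "real CARD('n) \<le> 10 + 4 * \<alpha>" for p u
    using * condition_of_dim_le[OF assms(1) that] that(1) by blast
  ultimately show ?thesis by force
qed

end
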